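(* Let $m$ be a nonnegative integer. For fixed $q\in\mathbb H$, the function $$A_{m;q}:t\longmapsto A_m(t;q):=\frac{1}{\pi^{3/4}}\frac{1}{\sqrt{2^mm!}}\,e^{-\frac{t^2}{2}-\frac{\overline q^{\,2}}{2}+\sqrt2\,\overline q\,t}\,H_m\!\left(\frac{q+\overline q}{\sqrt2}-t\right)$$ belongs to $L^2_{\mathbb H}(\mathbb R;dt)$, and $$\|A_{m;q}\|_{L^2_{\mathbb H}(\mathbb R;dt)}=\frac{1}{\sqrt\pi}e^{\frac{|q|^2}{2}}.$$ Moreover, for every $q\in\mathbb H$ and every $\phi\in L^2_{\mathbb H}(\mathbb R;dt)$, $$|[\mathcal B_m\phi](q)|\le\frac{1}{\sqrt\pi}e^{\frac{|q|^2}{2}}\|\phi\|_{L^2_{\mathbb H}(\mathbb R;dt)}.$$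
   Context: $\mathbb H$ is the division algebra of real quaternions. $L^2_{\mathbb H}(\mathbb R;dt)$ is the quaternionic Hilbert space of square integrable $\mathbb H$-valued functions on $\mathbb R$ with inner product $\langle f,g\rangle=\int_{\mathbb R}f(t)\overline{g(t)}\,dt$. $H_m(x)=(-1)^me^{x^2}\frac{d^m}{dx^m}e^{-x^2}$ is the real Hermite polynomial. The generalized quaternionic Segal-Bargmann transform is $$[\mathcal B_m\phi](q)=\int_{\mathbb R}A_m(t;q)\phi(t)\,dt .$$ *)

theory Defs
  imports "HOL-Analysis.Analysis"
begin

section \<open>The division algebra of real quaternions\<close>

datatype quat = Quat (qRe: real) (qIm1: real) (qIm2: real) (qIm3: real)

lemma quat_eq_iff:
  "x = y \<longleftrightarrow> qRe x = qRe y \<and> qIm1 x = qIm1 y \<and> qIm2 x = qIm2 y \<and> qIm3 x = qIm3 y"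
  by (cases x; cases y) simp

definition qcnj :: "quat \<Rightarrow> quat" where
  "qcnj q = Quat (qRe q) (- qIm1 q) (- qIm2 q) (- qIm3 q)"

lemma qcnj_sel [simp]:
  "qRe (qcnj q) = qRe q" "qIm1 (qcnj q) = - qIm1 q"
  "qIm2 (qcnj q) = - qIm2 q" "qIm3 (qcnj q) = - qIm3 q"
  by (simp_all add: qcnj_def)

instantiation quat :: ab_group_add
begin

definition zero_quat :: quat where
  "zero_quat = Quat 0 0 0 0"

definition plus_quat :: "quat \<Rightarrow> quat \<Rightarrow> quat" where
  "plus_quat x y = Quat (qRe x + qRe y) (qIm1 x + qIm1 y) (qIm2 x + qIm2 y) (qIm3 x + qIm3 y)"

definition uminus_quat :: "quat \<Rightarrow> quat" where
  "uminus_quat x = Quat (- qRe x) (- qIm1 x) (- qIm2 x) (- qIm3 x)"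

definition minus_quat :: "quat \<Rightarrow> quat \<Rightarrow> quat" where
  "minus_quat x y = Quat (qRe x - qRe y) (qIm1 x - qIm1 y) (qIm2 x - qIm2 y) (qIm3 x - qIm3 y)"

instance
  by standard
    (simp_all add: zero_quat_def plus_quat_def uminus_quat_def minus_quat_def quat_eq_iff)

end

lemma quat_add_sel [simp]:
  "qRe 0 = 0" "qIm1 0 = 0" "qIm2 0 = 0" "qIm3 0 = 0"
  "qRe (x + y) = qRe x + qRe y" "qIm1 (x + y) = qIm1 x + qIm1 y"
  "qIm2 (x + y) = qIm2 x + qIm2 y" "qIm3 (x + y) = qIm3 x + qIm3 y"
  "qRe (- x) = - qRe x" "qIm1 (- x) = - qIm1 x"
  "qIm2 (- x) = - qIm2 x" "qIm3 (- x) = - qIm3 x"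
  "qRe (x - y) = qRe x - qRe y" "qIm1 (x - y) = qIm1 x - qIm1 y"
  "qIm2 (x - y) = qIm2 x - qIm2 y" "qIm3 (x - y) = qIm3 x - qIm3 y"
  by (simp_all add: zero_quat_def plus_quat_def uminus_quat_def minus_quat_def)

instantiation quat :: real_algebra_1
begin

definition one_quat :: quat where
  "one_quat = Quat 1 0 0 0"

definition times_quat :: "quat \<Rightarrow> quat \<Rightarrow> quat" where
  "times_quat x y = Quat
     (qRe x * qRe y - qIm1 x * qIm1 y - qIm2 x * qIm2 y - qIm3 x * qIm3 y)
     (qRe x * qIm1 y + qIm1 x * qRe y + qIm2 x * qIm3 y - qIm3 x * qIm2 y)
     (qRe x * qIm2 y - qIm1 x * qIm3 y + qIm2 x * qRe y + qIm3 x * qIm1 y)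
     (qRe x * qIm3 y + qIm1 x * qIm2 y - qIm2 x * qIm1 y + qIm3 x * qRe y)"

definition scaleR_quat :: "real \<Rightarrow> quat \<Rightarrow> quat" where
  "scaleR_quat r x = Quat (r * qRe x) (r * qIm1 x) (r * qIm2 x) (r * qIm3 x)"

instance
  by standard
    (simp_all add: one_quat_def times_quat_def scaleR_quat_def quat_eq_iff algebra_simps)

end

lemma quat_mult_sel [simp]:
  "qRe 1 = 1" "qIm1 1 = 0" "qIm2 1 = 0" "qIm3 1 = 0"
  "qRe (x * y) = qRe x * qRe y - qIm1 x * qIm1 y - qIm2 x * qIm2 y - qIm3 x * qIm3 y"
  "qIm1 (x * y) = qRe x * qIm1 y + qIm1 x * qRe y + qIm2 x * qIm3 y - qIm3 x * qIm2 y"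
  "qIm2 (x * y) = qRe x * qIm2 y - qIm1 x * qIm3 y + qIm2 x * qRe y + qIm3 x * qIm1 y"
  "qIm3 (x * y) = qRe x * qIm3 y + qIm1 x * qIm2 y - qIm2 x * qIm1 y + qIm3 x * qRe y"
  "qRe (r *\<^sub>R x) = r * qRe x" "qIm1 (r *\<^sub>R x) = r * qIm1 x"
  "qIm2 (r *\<^sub>R x) = r * qIm2 x" "qIm3 (r *\<^sub>R x) = r * qIm3 x"
  by (simp_all add: one_quat_def times_quat_def scaleR_quat_def)

lemma quat_of_real_sel [simp]:
  "qRe (of_real r) = r" "qIm1 (of_real r) = 0" "qIm2 (of_real r) = 0" "qIm3 (of_real r) = 0"
  by (simp_all add: of_real_def)

instantiation quat :: real_inner
begin

definition inner_quat :: "quat \<Rightarrow> quat \<Rightarrow> real" where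
  "inner_quat x y = qRe x * qRe y + qIm1 x * qIm1 y + qIm2 x * qIm2 y + qIm3 x * qIm3 y"

definition norm_quat :: "quat \<Rightarrow> real" where
  "norm_quat x = sqrt ((qRe x)\<^sup>2 + (qIm1 x)\<^sup>2 + (qIm2 x)\<^sup>2 + (qIm3 x)\<^sup>2)"

definition sgn_quat :: "quat \<Rightarrow> quat" where
  "sgn_quat x = x /\<^sub>R norm x"

definition dist_quat :: "quat \<Rightarrow> quat \<Rightarrow> real" where
  "dist_quat x y = norm (x - y)"

definition uniformity_quat :: "(quat \<times> quat) filter" where
  "uniformity_quat = (INF e\<in>{0<..}. principal {(x, y). dist x y < e})"

definition open_quat :: "quat set \<Rightarrow> bool" where
  "open_quat U \<longleftrightarrow> (\<forall>x\<in>U. eventually (\<lambda>(x', y). x' = x \<longrightarrow> y \<in> U) uniformity)"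

instance
proof
  fix x :: quat
  have "inner x x = 0 \<longleftrightarrow> (qRe x)\<^sup>2 + (qIm1 x)\<^sup>2 + (qIm2 x)\<^sup>2 + (qIm3 x)\<^sup>2 = 0"
    by (simp add: inner_quat_def power2_eq_square)
  also have "\<dots> \<longleftrightarrow> x = 0"
    by (simp add: add_nonneg_eq_0_iff quat_eq_iff)
  finally show "inner x x = 0 \<longleftrightarrow> x = 0" .
qed (simp_all add: inner_quat_def norm_quat_def sgn_quat_def dist_quat_def
      uniformity_quat_def open_quat_def algebra_simps power2_eq_square)

end

instantiation quat :: inverse
begin

definition inverse_quat :: "quat \<Rightarrow> quat" where
  "inverse_quat x = qcnj x /\<^sub>R (norm x)\<^sup>2"

definition divide_quat :: "quat \<Rightarrow> quat \<Rightarrow> quat" where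
  "divide_quat x y = x * inverse y"

instance ..

end

instance quat :: real_normed_div_algebra
proof
  fix x y :: quat
  have sq: "(norm z)\<^sup>2 = qRe z * qRe z + qIm1 z * qIm1 z + qIm2 z * qIm2 z + qIm3 z * qIm3 z"
    for z :: quat
    by (simp add: norm_quat_def power2_eq_square)
  have c: "x * qcnj x = (norm x)\<^sup>2 *\<^sub>R 1" "qcnj x * x = (norm x)\<^sup>2 *\<^sub>R 1"
    unfolding quat_eq_iff sq by simp_all
  show "x \<noteq> 0 \<Longrightarrow> inverse x * x = 1" "x \<noteq> 0 \<Longrightarrow> x * inverse x = 1"
    by (simp_all add: inverse_quat_def c)
  show "x / y = x * inverse y"
    by (simp add: divide_quat_def)
  show "inverse (0::quat) = 0"
    by (simp add: inverse_quat_def)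
  have "(norm (x * y))\<^sup>2 = (norm x * norm y)\<^sup>2"
    unfolding power_mult_distrib sq quat_mult_sel by algebra
  then show "norm (x * y) = norm x * norm y"
    by simp
qed

instantiation quat :: euclidean_space
begin

definition Basis_quat :: "quat set" where
  "Basis_quat = {Quat 1 0 0 0, Quat 0 1 0 0, Quat 0 0 1 0, Quat 0 0 0 1}"

instance
proof
  fix u v :: quat
  show "u \<in> Basis \<Longrightarrow> v \<in> Basis \<Longrightarrow> inner u v = (if u = v then 1 else 0)"
    unfolding Basis_quat_def by (elim insertE emptyE) (simp_all add: inner_quat_def)
  show "(\<forall>v\<in>Basis. inner u v = 0) \<longleftrightarrow> u = 0"
    unfolding quat_eq_iff[of u 0] by (simp add: Basis_quat_def inner_quat_def)
qed (simp_all add: Basis_quat_def)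

end


section \<open>The Hilbert space of square integrable quaternion-valued functions\<close>

text \<open>
  Elements are represented by functions rather than by classes modulo equality almost
  everywhere; \<open>qL2_inner\<close>, \<open>qL2_norm\<close> and the integral transforms below do not depend on the
  representative.
\<close>

definition qL2 :: "(real \<Rightarrow> quat) set" where
  "qL2 = {f. f \<in> borel_measurable lebesgue \<and> integrable lebesgue (\<lambda>t. (norm (f t))\<^sup>2)}"

definition qL2_inner :: "(real \<Rightarrow> quat) \<Rightarrow> (real \<Rightarrow> quat) \<Rightarrow> quat" where
  "qL2_inner f g = (LINT t|lebesgue. f t * qcnj (g t))"

text \<open>
  The inner product of \<open>f\<close> with itself is a nonnegative real number, embedded in the
  quaternions; the real part recovers this number.
\<close>

definition qL2_norm :: "(real \<Rightarrow> quat) \<Rightarrow> real" where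
  "qL2_norm f = sqrt (qRe (qL2_inner f f))"


section \<open>The generalized Segal-Bargmann transform\<close>

definition hermite :: "nat \<Rightarrow> real \<Rightarrow> real" where
  "hermite m x = (-1) ^ m * exp (x\<^sup>2) * (deriv ^^ m) (\<lambda>u. exp (- u\<^sup>2)) x"

lemma quat_plus_cnj_real:
  "(q + qcnj q) /\<^sub>R sqrt 2 - of_real t = of_real (qRe ((q + qcnj q) /\<^sub>R sqrt 2 - of_real t))"
  unfolding quat_eq_iff quat_of_real_sel quat_add_sel quat_mult_sel qcnj_sel by simp

text \<open>
  By \<open>quat_plus_cnj_real\<close> the argument of the Hermite polynomial is a real quaternion, so
  taking its real part only changes its type.
\<close>

definition SB_kernel :: "nat \<Rightarrow> real \<Rightarrow> quat \<Rightarrow> quat" where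
  "SB_kernel m t q =
     (1 / pi powr (3/4) * (1 / sqrt (2 ^ m * fact m))) *\<^sub>R
       (exp (- of_real (t\<^sup>2 / 2) - (qcnj q)\<^sup>2 /\<^sub>R 2 + sqrt 2 *\<^sub>R qcnj q * of_real t)
        * of_real (hermite m (qRe ((q + qcnj q) /\<^sub>R sqrt 2 - of_real t))))"

definition SB_transform :: "nat \<Rightarrow> (real \<Rightarrow> quat) \<Rightarrow> quat \<Rightarrow> quat" where
  "SB_transform m \<phi> q = (LINT t|lebesgue. SB_kernel m t q * \<phi> t)"

end

theory Submission
  imports Defs "HOL-Probability.Distributions" "HOL-Computational_Algebra.Polynomial"
    "HOL-Real_Asymp.Real_Asymp"
begin

text \<open>
  Write \<open>x\<close> for the real part of \<open>q\<close>. The factor \<open>H\<^sub>m\<close> of the kernel is real, and the norm of a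
  quaternionic exponential is the exponential of the real part of its argument
  (\<open>norm_exp_quat\<close>). Completing the square in this real part, with
  \<open>s = \<surd>2 x - t\<close> being precisely the argument of the Hermite polynomial, gives
  \<open>|A\<^sub>m(t;q)|\<^sup>2 = exp(|q|\<^sup>2) H\<^sub>m(s)\<^sup>2 exp(-s\<^sup>2) / (\<pi>\<^bsup>3/2\<^esup> 2\<^sup>m m!)\<close>.
  So the dependence on \<open>q\<close> separates into the factor \<open>exp(|q|\<^sup>2)\<close> and a translation and reflection
  of the line, which does not change integrals (\<open>norm_SB_kernel_square\<close>). What remains is the
  classical value \<open>2\<^sup>m m! \<surd>\<pi>\<close> of the integral of \<open>H\<^sub>m\<^sup>2 exp(-s\<^sup>2)\<close> (\<open>integral_hermite_square\<close>);
  multiplied by the constants, it gives the squared norm \<open>exp(|q|\<^sup>2) / \<pi>\<close>.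

  The Hermite integral is computed by induction on \<open>m\<close>. The weight turns \<open>-d/ds\<close> into the raising
  operator \<open>p \<mapsto> 2 s p - p'\<close>, which maps \<open>H\<^sub>m\<close> to \<open>H\<^sub>m\<^sub>+\<^sub>1\<close>; its adjoint for the Gaussian inner
  product is \<open>d/ds\<close>, which maps \<open>H\<^sub>m\<^sub>+\<^sub>1\<close> to \<open>2(m+1) H\<^sub>m\<close>.

  The bound on the transform is the Cauchy-Schwarz inequality: since the quaternion norm is
  multiplicative, it reduces to the real inequality for \<open>|A\<^sub>m(t;q)|\<close> and \<open>|\<phi>(t)|\<close>.
\<close>

section \<open>Hermite polynomials\<close>

text \<open>
  The recursion is the one satisfied, up to the sign \<open>(-1)\<^sup>n\<close>, by the polynomial factors of the
  iterated derivatives of the Gaussian.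
\<close>

fun hermite_poly :: "nat \<Rightarrow> real poly" where
  "hermite_poly 0 = 1"
| "hermite_poly (Suc n) = [:0, 2:] * hermite_poly n - pderiv (hermite_poly n)"

text \<open>
  Differentiation commutes with the raising operator up to twice the identity, and each of the
  \<open>n + 1\<close> raising steps that produce \<open>hermite_poly (Suc n)\<close> contributes one such commutator.
\<close>
lemma pderiv_hermite_poly:
  "pderiv (hermite_poly (Suc n)) = smult (2 * real (Suc n)) (hermite_poly n)"
proof (induction n)
  case 0
  show ?case by (simp add: pderiv_pCons pderiv_1)
next
  case (Suc n)
  let ?H = hermite_poly
  have X: "pderiv [:0, 2:] = ([:2:] :: real poly)"
    by (simp add: pderiv_pCons)
  have "pderiv (?H (Suc (Suc n)))
      = [:0, 2:] * pderiv (?H (Suc n)) + smult 2 (?H (Suc n)) - pderiv (pderiv (?H (Suc n)))"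
    unfolding hermite_poly.simps(2)[of "Suc n"] pderiv_diff pderiv_mult X by simp
  also have "\<dots> = smult (2 * real (Suc n)) ([:0, 2:] * ?H n - pderiv (?H n)) + smult 2 (?H (Suc n))"
    unfolding Suc.IH pderiv_smult mult_smult_right smult_diff_right by algebra
  also have "\<dots> = smult (2 * real (Suc n) + 2) (?H (Suc n))"
    unfolding hermite_poly.simps(2)[symmetric] smult_add_left ..
  finally show ?case by (simp only: of_nat_Suc distrib_left mult_1_right add_ac)
qed

text \<open>
  Conjugated by the Gaussian, \<open>-d/dx\<close> becomes the raising operator. This yields both the
  iterated derivatives of the Gaussian and the vanishing integrals used for integration by parts.
\<close>
lemma has_real_derivative_poly_gauss:
  "((\<lambda>x. poly p x * exp (- x\<^sup>2)) has_real_derivative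
      - (poly ([:0, 2:] * p - pderiv p) x * exp (- x\<^sup>2))) (at x)"
  by (auto intro!: derivative_eq_intros poly_DERIV simp: algebra_simps)

lemma iterated_deriv_gauss:
  "(deriv ^^ n) (\<lambda>u. exp (- u\<^sup>2)) = (\<lambda>x::real. (-1) ^ n * (poly (hermite_poly n) x * exp (- x\<^sup>2)))"
proof (induction n)
  case (Suc n)
  show ?case
  proof
    fix x :: real
    have "(deriv ^^ Suc n) (\<lambda>u. exp (- u\<^sup>2)) x
        = deriv (\<lambda>x. (-1) ^ n * (poly (hermite_poly n) x * exp (- x\<^sup>2))) x"
      by (simp only: funpow.simps comp_def Suc.IH)
    also have "\<dots> = (-1) ^ n * - (poly (hermite_poly (Suc n)) x * exp (- x\<^sup>2))"
      unfolding hermite_poly.simps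
      by (intro DERIV_imp_deriv DERIV_cmult has_real_derivative_poly_gauss)
    finally show "(deriv ^^ Suc n) (\<lambda>u. exp (- u\<^sup>2)) x
        = (-1) ^ Suc n * (poly (hermite_poly (Suc n)) x * exp (- x\<^sup>2))"
      by (simp only: power_Suc mult_minus_left mult_minus_right mult_1_left)
  qed
qed simp

lemma hermite_eq_poly: "hermite m x = poly (hermite_poly m) x"
proof -
  have "(-1) ^ m * ((-1) ^ m * y) = y" for y :: real
    unfolding mult.assoc[symmetric] power_mult_distrib[symmetric] by simp
  then show ?thesis
    unfolding hermite_def iterated_deriv_gauss by (simp add: exp_minus field_simps)
qed

section \<open>Integration against the Gaussian weight\<close>

lemma has_bochner_integral_gauss: "has_bochner_integral lborel (\<lambda>x::real. exp (- x\<^sup>2)) (sqrt pi)"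
  using has_bochner_integral_even_function[OF gaussian_moment_0] by simp

text \<open>
  The powers of \<open>x\<close> are integrable as moments of the normal distribution with standard
  deviation \<open>1 / \<surd>2\<close>, whose density is \<open>exp (- x\<^sup>2) / sqrt pi\<close>.
\<close>
lemma integrable_poly_gauss: "integrable lborel (\<lambda>x::real. poly p x * exp (- x\<^sup>2))"
proof -
  have "integrable lborel (\<lambda>x::real. x ^ i * exp (- x\<^sup>2))" for i
    using integrable_mult_left[OF integrable_normal_moment[of "1 / sqrt 2" 0 i], of "sqrt pi"]
    by (simp add: normal_density_def power_divide mult.commute)
  then have "integrable lborel (\<lambda>x::real. \<Sum>i\<le>degree p. coeff p i * (x ^ i * exp (- x\<^sup>2)))"
    by auto
  then show ?thesis
    by (simp add: poly_altdef sum_distrib_right mult.assoc)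
qed

lemma poly_gauss_tendsto_0_at_top: "((\<lambda>x::real. poly p x * exp (- x\<^sup>2)) \<longlongrightarrow> 0) at_top"
proof -
  have "((\<lambda>x. (\<Sum>i\<le>degree p. coeff p i * (x ^ i / exp x)) * exp (x - x\<^sup>2)) \<longlongrightarrow>
          (\<Sum>i\<le>degree p. coeff p i * 0) * 0) at_top"
    by (intro tendsto_intros tendsto_power_div_exp_0) real_asymp
  moreover have "(\<Sum>i\<le>degree p. coeff p i * (x ^ i / exp x)) * exp (x - x\<^sup>2) = poly p x * exp (- x\<^sup>2)"
    for x :: real
    unfolding poly_altdef sum_distrib_right
    by (intro sum.cong refl) (simp add: exp_diff exp_minus field_simps)
  ultimately show ?thesis by simp
qed

lemma poly_gauss_tendsto_0_at_bot: "((\<lambda>x::real. poly p x * exp (- x\<^sup>2)) \<longlongrightarrow> 0) at_bot"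
  using poly_gauss_tendsto_0_at_top[of "pcompose p [:0, -1:]"]
  by (simp add: filterlim_at_bot_mirror poly_pcompose)

text \<open>
  The integrand is, up to sign, the derivative of \<open>p(x) exp (- x\<^sup>2)\<close>, which vanishes at both
  ends of the line. Applied to a product \<open>p = f g\<close>, this is integration by parts: the raising
  operator acting on \<open>f\<close> may be traded for differentiation of \<open>g\<close>.
\<close>
lemma integral_raised_gauss_eq_0:
  fixes p :: "real poly"
  shows "(LINT x|lborel. poly ([:0, 2:] * p - pderiv p) x * exp (- x\<^sup>2)) = 0"
proof -
  define f where "f = (\<lambda>x::real. - (poly ([:0, 2:] * p - pderiv p) x * exp (- x\<^sup>2)))"
  have "(LBINT x=-\<infinity>..\<infinity>. f x) = 0 - 0"
  proof (rule interval_integral_FTC_integrable[where F = "\<lambda>x. poly p x * exp (- x\<^sup>2)"])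
    show "((\<lambda>x. poly p x * exp (- x\<^sup>2)) has_vector_derivative f x) (at x)" for x
      unfolding f_def has_real_derivative_iff_has_vector_derivative[symmetric]
      by (rule has_real_derivative_poly_gauss)
    show "isCont f x" for x
      unfolding f_def by (intro continuous_intros)
    show "set_integrable lborel (einterval (-\<infinity>) \<infinity>) f"
      unfolding f_def set_integrable_def
      using integrable_poly_gauss[of "[:0, 2:] * p - pderiv p"] by simp
  qed (use poly_gauss_tendsto_0_at_top[of p] poly_gauss_tendsto_0_at_bot[of p] in
        \<open>simp_all only: ereal_tendsto_simps, simp_all\<close>)
  then show ?thesis
    by (simp add: f_def interval_lebesgue_integral_def set_lebesgue_integral_def)
qed

lemma integral_hermite_square:
  "(LINT x|lborel. (poly (hermite_poly m) x)\<^sup>2 * exp (- x\<^sup>2)) = 2 ^ m * fact m * sqrt pi"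
proof (induction m)
  case 0
  show ?case
    using has_bochner_integral_integral_eq[OF has_bochner_integral_gauss] by simp
next
  case (Suc m)
  let ?H = hermite_poly
  let ?P = "?H m * ?H (Suc m)"
  \<comment> \<open>One factor \<open>H\<^sub>m\<^sub>+\<^sub>1\<close> is written as the raised \<open>H\<^sub>m\<close> and, up to the derivative of
    \<open>H\<^sub>m H\<^sub>m\<^sub>+\<^sub>1 exp(-x\<^sup>2)\<close>, the raising is moved to the other factor as a derivative.\<close>
  have "(poly (?H (Suc m)) x)\<^sup>2 * exp (- x\<^sup>2)
      = poly ([:0, 2:] * ?P - pderiv ?P) x * exp (- x\<^sup>2)
        + 2 * real (Suc m) * (poly (?H m * ?H m) x * exp (- x\<^sup>2))" for x
  proof -
    have "?H (Suc m) * ?H (Suc m) = [:0, 2:] * ?P - pderiv ?P + ?H m * pderiv (?H (Suc m))"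
      unfolding pderiv_mult by (subst (1) hermite_poly.simps(2)) algebra
    then have "poly (?H (Suc m) * ?H (Suc m)) x
        = poly ([:0, 2:] * ?P - pderiv ?P) x + poly (?H m * smult (2 * real (Suc m)) (?H m)) x"
      unfolding pderiv_hermite_poly poly_add[symmetric] by (rule arg_cong)
    then show ?thesis
      unfolding power2_eq_square poly_mult[symmetric]
      by (simp only: mult_smult_right poly_smult) argo
  qed
  then have "(LINT x|lborel. (poly (?H (Suc m)) x)\<^sup>2 * exp (- x\<^sup>2))
      = (LINT x|lborel. poly ([:0, 2:] * ?P - pderiv ?P) x * exp (- x\<^sup>2))
        + 2 * real (Suc m) * (LINT x|lborel. poly (?H m * ?H m) x * exp (- x\<^sup>2))"
    by (simp only: Bochner_Integration.integral_add integrable_poly_gauss integrable_mult_right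
        integral_mult_right_zero)
  also have "\<dots> = 2 * real (Suc m) * (2 ^ m * fact m * sqrt pi)"
    unfolding integral_raised_gauss_eq_0 Suc.IH[symmetric] by (simp add: power2_eq_square)
  finally show ?case by simp
qed

section \<open>Quaternions\<close>

lemma norm_qcnj: "norm (qcnj q) = norm q"
  by (simp add: norm_quat_def)

lemma qcnj_mult: "qcnj (x * y) = qcnj y * qcnj x"
  by (simp add: quat_eq_iff algebra_simps)

lemma mult_qcnj: "q * qcnj q = of_real ((norm q)\<^sup>2)"
  by (simp add: quat_eq_iff norm_quat_def power2_eq_square algebra_simps)

lemma bounded_linear_qcnj: "bounded_linear qcnj"
  by (rule bounded_linear_intro[where K = 1]) (simp_all add: quat_eq_iff norm_qcnj)

lemma bounded_linear_qRe: "bounded_linear qRe"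
  by (rule bounded_linear_intro[where K = 1])
    (auto simp: norm_quat_def intro!: real_le_rsqrt)

text \<open>
  Conjugation reverses products, but this is invisible on powers of a single element, so it can be
  applied term by term to the exponential series.
\<close>
lemma exp_qcnj: "exp (qcnj q) = qcnj (exp q)"
proof -
  have pow: "qcnj (q ^ n) = qcnj q ^ n" for n
  proof (induction n)
    case 0
    show ?case by (simp add: quat_eq_iff)
  next
    case (Suc n)
    then show ?case by (simp add: qcnj_mult power_commutes)
  qed
  have "(\<lambda>n. qcnj (q ^ n /\<^sub>R fact n)) sums qcnj (exp q)"
    by (intro bounded_linear.sums[OF bounded_linear_qcnj] exp_converges)
  moreover have "qcnj (q ^ n /\<^sub>R fact n) = qcnj q ^ n /\<^sub>R fact n" for n
    by (simp add: linear_scale[OF bounded_linear.linear[OF bounded_linear_qcnj]] pow)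
  ultimately show ?thesis
    using exp_converges[of "qcnj q"] sums_unique2 by auto
qed

text \<open>
  A quaternion commutes with its conjugate, so the squared norm \<open>exp q * qcnj (exp q)\<close> is the
  exponential of the real number \<open>q + qcnj q\<close>.
\<close>
lemma norm_exp_quat: "norm (exp q) = exp (qRe q)" for q :: quat
proof -
  have "exp q * qcnj (exp q) = exp (q + qcnj q)"
    unfolding exp_qcnj[symmetric]
    by (rule exp_add_commuting[symmetric]) (simp add: quat_eq_iff algebra_simps)
  also have "q + qcnj q = of_real (2 * qRe q)"
    by (simp add: quat_eq_iff del: of_real_mult)
  finally have "of_real ((norm (exp q))\<^sup>2) = (of_real (exp (2 * qRe q)) :: quat)"
    unfolding mult_qcnj exp_of_real .
  then have "(norm (exp q))\<^sup>2 = (exp (qRe q))\<^sup>2"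
    by (simp only: of_real_eq_iff exp_double)
  then show ?thesis by simp
qed

section \<open>Square integrable functions\<close>

lemma qL2_norm_eq:
  assumes "f \<in> qL2"
  shows "qL2_norm f = sqrt (LINT t|lebesgue. (norm (f t))\<^sup>2)"
proof -
  have "integrable lebesgue (\<lambda>t. (of_real ((norm (f t))\<^sup>2) :: quat))"
    using assms unfolding qL2_def by (intro integrable_bounded_linear[OF bounded_linear_of_real]) auto
  from integral_bounded_linear[OF bounded_linear_qRe this] show ?thesis
    unfolding qL2_norm_def qL2_inner_def mult_qcnj by (simp del: of_real_power)
qed

lemma Cauchy_Schwarz_integral:
  fixes f g :: "'a \<Rightarrow> real"
  assumes [measurable]: "f \<in> borel_measurable M" "g \<in> borel_measurable M"
    and f: "integrable M (\<lambda>x. (f x)\<^sup>2)" and g: "integrable M (\<lambda>x. (g x)\<^sup>2)"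
  shows "integrable M (\<lambda>x. f x * g x)"
    and "(LINT x|M. f x * g x) \<le> sqrt (LINT x|M. (f x)\<^sup>2) * sqrt (LINT x|M. (g x)\<^sup>2)"
proof -
  show fg: "integrable M (\<lambda>x. f x * g x)"
  proof (rule Bochner_Integration.integrable_bound)
    show "integrable M (\<lambda>x. (f x)\<^sup>2 + (g x)\<^sup>2)"
      using f g by simp
    have "\<bar>a * b\<bar> \<le> a\<^sup>2 + b\<^sup>2" for a b :: real
      using sum_squares_bound[of "\<bar>a\<bar>" "\<bar>b\<bar>"] mult_nonneg_nonneg[of "\<bar>a\<bar>" "\<bar>b\<bar>"]
      unfolding abs_mult power2_abs by linarith
    then show "AE x in M. norm (f x * g x) \<le> norm ((f x)\<^sup>2 + (g x)\<^sup>2)"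
      by auto
  qed measurable
  define F G I where "F = (LINT x|M. (f x)\<^sup>2)" and "G = (LINT x|M. (g x)\<^sup>2)"
    and "I = (LINT x|M. f x * g x)"
  \<comment> \<open>Integrating \<open>(c f - g)\<^sup>2 \<ge> 0\<close> gives a quadratic in \<open>c\<close> without sign change. It is used at its
    minimum \<open>c = I / F\<close>; if \<open>F = 0\<close> it is linear, so its slope must vanish.\<close>
  have quadratic: "0 \<le> c\<^sup>2 * F - 2 * c * I + G" for c
  proof -
    have "0 \<le> (LINT x|M. (c * f x - g x)\<^sup>2)"
      by simp
    also have "\<dots> = (LINT x|M. c\<^sup>2 * (f x)\<^sup>2 - 2 * c * (f x * g x) + (g x)\<^sup>2)"
      by (simp add: power2_diff power_mult_distrib algebra_simps)
    also have "\<dots> = c\<^sup>2 * F - 2 * c * I + G"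
      using f g fg by (simp add: F_def G_def I_def del: mult.assoc)
    finally show ?thesis .
  qed
  have "I\<^sup>2 \<le> F * G"
  proof (cases "F = 0")
    case True
    have "I = 0"
    proof (rule ccontr)
      assume "I \<noteq> 0"
      then show False
        using quadratic[of "(G + 1) / (2 * I)"] True by simp
    qed
    with True show ?thesis by simp
  next
    case False
    then have "0 < F"
      unfolding F_def by (simp add: order_less_le)
    then show ?thesis
      using quadratic[of "I / F"] by (simp add: field_simps power2_eq_square)
  qed
  then have "\<bar>I\<bar> \<le> sqrt (F * G)"
    by (simp add: real_le_rsqrt)
  then show "I \<le> sqrt F * sqrt G"
    by (simp add: real_sqrt_mult)
qed

lemma Cauchy_Schwarz_qL2:
  assumes f: "f \<in> qL2" and g: "g \<in> qL2"
  shows "integrable lebesgue (\<lambda>t. f t * g t)"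
    and "norm (LINT t|lebesgue. f t * g t) \<le> qL2_norm f * qL2_norm g"
proof -
  have [measurable]: "f \<in> borel_measurable lebesgue" "g \<in> borel_measurable lebesgue"
    using f g by (auto simp: qL2_def)
  have "integrable lebesgue (\<lambda>t. (norm (f t))\<^sup>2)" "integrable lebesgue (\<lambda>t. (norm (g t))\<^sup>2)"
    using f g by (auto simp: qL2_def)
  then have int: "integrable lebesgue (\<lambda>t. norm (f t * g t))"
    and le: "(LINT t|lebesgue. norm (f t * g t)) \<le> qL2_norm f * qL2_norm g"
    unfolding norm_mult qL2_norm_eq[OF f] qL2_norm_eq[OF g]
    by (intro Cauchy_Schwarz_integral; simp)+
  show "integrable lebesgue (\<lambda>t. f t * g t)"
    using int by (rule integrable_norm_cancel) simp
  show "norm (LINT t|lebesgue. f t * g t) \<le> qL2_norm f * qL2_norm g"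
    using integral_norm_bound le by (rule order_trans)
qed

section \<open>The kernel\<close>

text \<open>
  Here \<open>(-1) * t\<close> stands for \<open>- t\<close> so that the right-hand side is visibly a function composed with
  an affine map of \<open>t\<close>, as the change of variables in the integral requires.
\<close>
lemma norm_SB_kernel_square:
  "(norm (SB_kernel m t q))\<^sup>2 = exp ((norm q)\<^sup>2) / (pi powr (3/2) * (2 ^ m * fact m))
      * ((poly (hermite_poly m) (sqrt 2 * qRe q + (-1) * t))\<^sup>2
          * exp (- (sqrt 2 * qRe q + (-1) * t)\<^sup>2))"
proof -
  let ?w = "- of_real (t\<^sup>2 / 2) - (qcnj q)\<^sup>2 /\<^sub>R 2 + sqrt 2 *\<^sub>R qcnj q * of_real t"
  let ?s = "sqrt 2 * qRe q + (-1) * t"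
  have "sqrt 2 * sqrt 2 = (2::real)" by simp
  then have arg: "qRe ((q + qcnj q) /\<^sub>R sqrt 2 - of_real t) = ?s"
    by (simp add: field_simps)
  have "2 * qRe ?w = (norm q)\<^sup>2 - ?s\<^sup>2"
    by (simp add: power2_eq_square[of "qcnj q"] norm_quat_def power2_diff power_mult_distrib
        del: of_real_divide of_real_power of_real_mult)
      (simp add: power2_eq_square field_simps)
  then have "(norm (exp ?w))\<^sup>2 = exp ((norm q)\<^sup>2) * exp (- ?s\<^sup>2)"
    unfolding norm_exp_quat exp_double[symmetric] exp_add[symmetric] by simp
  moreover have "(1 / pi powr (3/4) * (1 / sqrt (2 ^ m * fact m)))\<^sup>2
      = 1 / (pi powr (3/2) * (2 ^ m * fact m))"
    by (simp add: power_mult_distrib power_divide powr_power)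
  ultimately show ?thesis
    unfolding SB_kernel_def arg hermite_eq_poly norm_scaleR norm_mult norm_of_real power_mult_distrib
      power2_abs
    by simp
qed

text \<open>
  Quaternions do not commute, so \<open>exp\<close> of a sum does not split in general. Here all three summands
  of the exponent are real polynomials in \<open>qcnj q\<close> and do commute. After the splitting, \<open>t\<close> enters
  only through a real exponential and the one-parameter group \<open>exp (t *\<^sub>R b)\<close>, which is even
  differentiable.
\<close>
lemma continuous_SB_kernel: "continuous_on UNIV (\<lambda>t. SB_kernel m t q)"
proof -
  let ?a = "- ((qcnj q)\<^sup>2 /\<^sub>R 2)" and ?b = "sqrt 2 *\<^sub>R qcnj q"
  have "exp (- of_real (t\<^sup>2 / 2) - (qcnj q)\<^sup>2 /\<^sub>R 2 + ?b * of_real t)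
      = of_real (exp (- (t\<^sup>2 / 2))) * (exp ?a * exp (t *\<^sub>R ?b))" for t
  proof -
    have "exp (?a + t *\<^sub>R ?b) = exp ?a * exp (t *\<^sub>R ?b)"
      by (rule exp_add_commuting) (simp add: power2_eq_square mult.assoc)
    moreover have "exp (of_real (- (t\<^sup>2 / 2)) + (?a + t *\<^sub>R ?b))
        = exp (of_real (- (t\<^sup>2 / 2))) * exp (?a + t *\<^sub>R ?b)"
      by (rule exp_add_commuting) (simp add: of_real_def)
    moreover have "- of_real (t\<^sup>2 / 2) - (qcnj q)\<^sup>2 /\<^sub>R 2 + ?b * of_real t
        = of_real (- (t\<^sup>2 / 2)) + (?a + t *\<^sub>R ?b)"
      by (simp add: of_real_def)
    ultimately show ?thesis
      by (simp only: exp_of_real)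
  qed
  moreover have "continuous_on UNIV (\<lambda>t. exp (t *\<^sub>R ?b))"
    by (intro continuous_at_imp_continuous_on ballI has_vector_derivative_continuous)
      (rule exp_scaleR_has_vector_derivative_right)
  ultimately show ?thesis
    unfolding SB_kernel_def hermite_eq_poly
    by (simp only:, intro continuous_intros) (auto intro!: continuous_intros simp: of_real_def)
qed

lemma SB_kernel_square_integral:
  "has_bochner_integral lebesgue (\<lambda>t. (norm (SB_kernel m t q))\<^sup>2) (exp ((norm q)\<^sup>2) / pi)"
proof -
  let ?h = "\<lambda>s::real. (poly (hermite_poly m) s)\<^sup>2 * exp (- s\<^sup>2)"
  let ?c = "exp ((norm q)\<^sup>2) / (pi powr (3/2) * (2 ^ m * fact m))"
  have "has_bochner_integral lborel ?h (2 ^ m * fact m * sqrt pi)"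
    using integrable_poly_gauss[of "hermite_poly m * hermite_poly m"] integral_hermite_square[of m]
    by (simp add: has_bochner_integral_iff power2_eq_square)
  then have "has_bochner_integral lborel (\<lambda>t. ?c * ?h (sqrt 2 * qRe q + (-1) * t))
      (?c * (2 ^ m * fact m * sqrt pi))"
    by (subst (asm) lborel_has_bochner_integral_real_affine_iff
          [where c = "-1" and t = "sqrt 2 * qRe q"])
      (simp, intro has_bochner_integral_mult_right, simp)
  moreover have "?c * (2 ^ m * fact m * sqrt pi) = exp ((norm q)\<^sup>2) / pi"
  proof -
    have "pi powr (3/2) = pi powr (1 + 1/2)" by simp
    also have "\<dots> = pi * sqrt pi"
      unfolding powr_add by (simp add: powr_half_sqrt)
    finally show ?thesis by simp
  qed
  ultimately have "has_bochner_integral lborel (\<lambda>t. (norm (SB_kernel m t q))\<^sup>2) (exp ((norm q)\<^sup>2) / pi)"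
    unfolding norm_SB_kernel_square by simp
  moreover have "(\<lambda>t. (norm (SB_kernel m t q))\<^sup>2) \<in> borel_measurable lborel"
    using borel_measurable_continuous_onI[OF continuous_SB_kernel, of m q] by simp
  ultimately show ?thesis
    by (simp add: has_bochner_integral_iff integrable_completion integral_completion)
qed

lemma SB_kernel_in_qL2: "(\<lambda>t. SB_kernel m t q) \<in> qL2"
  using SB_kernel_square_integral[of m q] borel_measurable_continuous_onI[OF continuous_SB_kernel, of m q]
  by (auto simp: qL2_def has_bochner_integral_iff intro!: measurable_completion)

lemma qL2_norm_SB_kernel:
  "qL2_norm (\<lambda>t. SB_kernel m t q) = 1 / sqrt pi * exp ((norm q)\<^sup>2 / 2)"
proof -
  have "exp ((norm q)\<^sup>2) = (exp ((norm q)\<^sup>2 / 2))\<^sup>2"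
    by (simp flip: exp_double)
  then show ?thesis
    unfolding qL2_norm_eq[OF SB_kernel_in_qL2]
      has_bochner_integral_integral_eq[OF SB_kernel_square_integral]
    by (simp add: real_sqrt_divide)
qed

section \<open>Norm of the kernel and bound on the transform\<close>

theorem theorem6p2:
  fixes m :: nat
  shows "(\<forall>q::quat.
            (\<lambda>t. SB_kernel m t q) \<in> qL2 \<and>
            qL2_norm (\<lambda>t. SB_kernel m t q) = 1 / sqrt pi * exp ((norm q)\<^sup>2 / 2)) \<and>
         (\<forall>q::quat. \<forall>\<phi>\<in>qL2.
            integrable lebesgue (\<lambda>t. SB_kernel m t q * \<phi> t) \<and>
            norm (SB_transform m \<phi> q) \<le> 1 / sqrt pi * exp ((norm q)\<^sup>2 / 2) * qL2_norm \<phi>)"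
proof (intro conjI allI ballI)
  fix q :: quat
  show "(\<lambda>t. SB_kernel m t q) \<in> qL2"
    by (rule SB_kernel_in_qL2)
  show "qL2_norm (\<lambda>t. SB_kernel m t q) = 1 / sqrt pi * exp ((norm q)\<^sup>2 / 2)"
    by (rule qL2_norm_SB_kernel)
  fix \<phi> assume "\<phi> \<in> qL2"
  note CS = Cauchy_Schwarz_qL2[OF SB_kernel_in_qL2[of m q] this]
  show "integrable lebesgue (\<lambda>t. SB_kernel m t q * \<phi> t)"
    by (rule CS(1))
  show "norm (SB_transform m \<phi> q) \<le> 1 / sqrt pi * exp ((norm q)\<^sup>2 / 2) * qL2_norm \<phi>"
    using CS(2) unfolding SB_transform_def qL2_norm_SB_kernel .
qed

end
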